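(* Let $n\ge 1$ and let $g=(A,w)$ be an element of $\mathrm{U}(n)\ltimes\mathbb{C}^n$. Then the following are equivalent. (1) $g$ is reversible in $\mathrm{U}(n)\ltimes\mathbb{C}^n$. (2) $g$ is strongly reversible in $\mathrm{U}(n)\ltimes\mathbb{C}^n$. (3) $A$ is strongly reversible in $\mathrm{U}(n)$. (4) The characteristic polynomial of $A$ is self-dual.
   Context: $\mathrm{U}(n)$ is the group of complex unitary $n\times n$ matrices. Elements of $\mathrm{U}(n)\ltimes\mathbb{C}^n$ are pairs $(A,w)$ with $A\in\mathrm{U}(n)$, $w\in\mathbb{C}^n$, acting as the affine maps $z\mapsto Az+w$ of $\mathbb{C}^n$; the group operation is composition. An element $g$ of a group $G$ is reversible in $G$ if there is $h\in G$ with $hgh^{-1}=g^{-1}$, and strongly reversible in $G$ if such an $h$ can be chosen with $h^2=1$. For $A\in \mathrm{U}(n)$, the characteristic polynomial of $A$ is self-dual if whenever $\lambda\neq\pm1$ is a root of it, so is $\lambda^{-1}$, with the same multiplicity. *)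

theory Defs
  imports
    "HOL-Algebra.Group"
    "Jordan_Normal_Form.Schur_Decomposition"
begin

definition reversible :: "('a, 'b) monoid_scheme \<Rightarrow> 'a \<Rightarrow> bool" where
  "reversible G g \<longleftrightarrow>
    (\<exists>h\<in>carrier G. h \<otimes>\<^bsub>G\<^esub> g \<otimes>\<^bsub>G\<^esub> inv\<^bsub>G\<^esub> h = inv\<^bsub>G\<^esub> g)"

definition strongly_reversible :: "('a, 'b) monoid_scheme \<Rightarrow> 'a \<Rightarrow> bool" where
  "strongly_reversible G g \<longleftrightarrow>
    (\<exists>h\<in>carrier G. h \<otimes>\<^bsub>G\<^esub> g \<otimes>\<^bsub>G\<^esub> inv\<^bsub>G\<^esub> h = inv\<^bsub>G\<^esub> g \<and>
      h \<otimes>\<^bsub>G\<^esub> h = \<one>\<^bsub>G\<^esub>)"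

definition unitary_mat :: "nat \<Rightarrow> complex mat \<Rightarrow> bool" where
  "unitary_mat n A \<longleftrightarrow>
    A \<in> carrier_mat n n \<and> mat_adjoint A * A = 1\<^sub>m n \<and> A * mat_adjoint A = 1\<^sub>m n"

definition unitary_group :: "nat \<Rightarrow> complex mat monoid" where
  "unitary_group n = \<lparr>carrier = {A. unitary_mat n A}, monoid.mult = (*), one = 1\<^sub>m n\<rparr>"

definition affine_act :: "complex mat \<times> complex vec \<Rightarrow> complex vec \<Rightarrow> complex vec" where
  "affine_act g z = fst g *\<^sub>v z + snd g"

text \<open>The product is the one for which \<open>affine_act\<close> turns multiplication into composition
  of maps; see \<open>affine_act_mult\<close> and \<open>affine_act_inj\<close> below.\<close>

definition affine_unitary_group :: "nat \<Rightarrow> (complex mat \<times> complex vec) monoid" where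
  "affine_unitary_group n =
    \<lparr>carrier = {A. unitary_mat n A} \<times> carrier_vec n,
     monoid.mult = (\<lambda>(A, w) (B, v). (A * B, A *\<^sub>v v + w)),
     one = (1\<^sub>m n, 0\<^sub>v n)\<rparr>"

text \<open>The qualified \<open>Polynomial.order\<close> is the multiplicity of a root. Only polynomials with
  nonzero constant term are of interest, so the convention \<open>inverse 0 = 0\<close> plays no role.\<close>

definition self_dual :: "complex poly \<Rightarrow> bool" where
  "self_dual p \<longleftrightarrow>
    (\<forall>a. poly p a = 0 \<and> a \<noteq> 1 \<and> a \<noteq> -1 \<longrightarrow>
      poly p (inverse a) = 0 \<and> Polynomial.order (inverse a) p = Polynomial.order a p)"

lemma dim_mat_adjoint [simp]:
  "dim_row (mat_adjoint A) = dim_col A" "dim_col (mat_adjoint A) = dim_row A"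
  by (simp_all add: mat_adjoint_def)

lemma mat_adjoint_carrier:
  "A \<in> carrier_mat n m \<Longrightarrow> mat_adjoint A \<in> carrier_mat m n"
  by (intro carrier_matI) (simp_all add: carrier_matD)

lemma mat_adjoint_index [simp]:
  "i < dim_col A \<Longrightarrow> j < dim_row A \<Longrightarrow> mat_adjoint A $$ (i, j) = conjugate (A $$ (j, i))"
  by (simp add: mat_adjoint_def mat_of_rows_def)

lemma mat_adjoint_adjoint: "mat_adjoint (mat_adjoint A) = A"
  by (rule eq_matI) simp_all

lemma mat_adjoint_mult:
  assumes "dim_col (A :: complex mat) = dim_row B"
  shows "mat_adjoint (A * B) = mat_adjoint B * mat_adjoint A"
  using assms
  by (intro eq_matI) (auto simp: scalar_prod_def mult.commute intro!: sum.cong)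

lemma mat_adjoint_one: "mat_adjoint (1\<^sub>m n :: complex mat) = 1\<^sub>m n"
  by (rule eq_matI) auto

lemma unitary_mat_carrier: "unitary_mat n A \<Longrightarrow> A \<in> carrier_mat n n"
  by (simp add: unitary_mat_def)

lemma unitary_mat_one: "unitary_mat n (1\<^sub>m n)"
  by (simp add: unitary_mat_def mat_adjoint_one)

lemma unitary_mat_adjoint: "unitary_mat n A \<Longrightarrow> unitary_mat n (mat_adjoint A)"
  unfolding unitary_mat_def by (auto simp: mat_adjoint_adjoint mat_adjoint_carrier)

lemma unitary_mat_mult:
  assumes "unitary_mat n A" "unitary_mat n B"
  shows "unitary_mat n (A * B)"
proof -
  have A: "A \<in> carrier_mat n n" "mat_adjoint A * A = 1\<^sub>m n" "A * mat_adjoint A = 1\<^sub>m n"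
    and B: "B \<in> carrier_mat n n" "mat_adjoint B * B = 1\<^sub>m n" "B * mat_adjoint B = 1\<^sub>m n"
    using assms by (auto simp: unitary_mat_def)
  note A' = mat_adjoint_carrier[OF A(1)] and B' = mat_adjoint_carrier[OF B(1)]
  have "mat_adjoint (A * B) * (A * B) = mat_adjoint B * (mat_adjoint A * A) * B"
    using A(1) B(1) A' B' by (simp add: mat_adjoint_mult assoc_mult_mat[of _ n n _ n _ n])
  also have "\<dots> = 1\<^sub>m n" using A B B' by simp
  finally have 1: "mat_adjoint (A * B) * (A * B) = 1\<^sub>m n" .
  have "(A * B) * mat_adjoint (A * B) = A * (B * mat_adjoint B) * mat_adjoint A"
    using A(1) B(1) A' B' by (simp add: mat_adjoint_mult assoc_mult_mat[of _ n n _ n _ n])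
  also have "\<dots> = 1\<^sub>m n" using A B A' by simp
  finally show ?thesis using 1 A(1) B(1) by (simp add: unitary_mat_def)
qed

lemma group_unitary_group: "group (unitary_group n)"
proof (rule groupI)
  fix A assume "A \<in> carrier (unitary_group n)"
  then show "\<exists>B\<in>carrier (unitary_group n). B \<otimes>\<^bsub>unitary_group n\<^esub> A = \<one>\<^bsub>unitary_group n\<^esub>"
    by (intro bexI[of _ "mat_adjoint A"])
       (auto simp: unitary_group_def unitary_mat_adjoint, simp add: unitary_mat_def)
qed (auto simp: unitary_group_def unitary_mat_one unitary_mat_mult
       dest!: unitary_mat_carrier intro!: assoc_mult_mat[of _ n n _ n _ n] left_mult_one_mat)

lemma affine_act_mult:
  assumes "g \<in> carrier (affine_unitary_group n)" "h \<in> carrier (affine_unitary_group n)"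
    "z \<in> carrier_vec n"
  shows "affine_act (g \<otimes>\<^bsub>affine_unitary_group n\<^esub> h) z = affine_act g (affine_act h z)"
  using assms
  by (auto simp: affine_unitary_group_def affine_act_def mult_add_distrib_mat_vec[of _ n n]
      assoc_add_vec[of _ n] assoc_mult_mat_vec[of _ n n _ n] dest!: unitary_mat_carrier)

lemma affine_act_inj:
  assumes g: "g \<in> carrier (affine_unitary_group n)" and h: "h \<in> carrier (affine_unitary_group n)"
    and eq: "\<And>z. z \<in> carrier_vec n \<Longrightarrow> affine_act g z = affine_act h z"
  shows "g = h"
proof -
  obtain A v B w where gh: "g = (A, v)" "h = (B, w)" by (cases g, cases h)
  have c: "A \<in> carrier_mat n n" "B \<in> carrier_mat n n" "v \<in> carrier_vec n" "w \<in> carrier_vec n"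
    using g h by (auto simp: gh affine_unitary_group_def dest: unitary_mat_carrier)
  have z: "C *\<^sub>v 0\<^sub>v n = 0\<^sub>v n" if "C \<in> carrier_mat n n" for C :: "complex mat"
    using that by (intro eq_vecI) auto
  have vw: "v = w" using eq[of "0\<^sub>v n"] c by (simp add: gh affine_act_def z)
  have "A *\<^sub>v z = B *\<^sub>v z" if zc: "z \<in> carrier_vec n" for z
  proof (rule eq_vecI)
    show "dim_vec (A *\<^sub>v z) = dim_vec (B *\<^sub>v z)" using c by auto
    fix i assume i: "i < dim_vec (B *\<^sub>v z)"
    have "(A *\<^sub>v z + w) $ i = (B *\<^sub>v z + w) $ i"
      using eq[OF zc] by (simp add: gh affine_act_def vw)
    then show "(A *\<^sub>v z) $ i = (B *\<^sub>v z) $ i" using i c by simp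
  qed
  moreover have "C *\<^sub>v unit_vec n j = col C j"
    if "C \<in> carrier_mat n n" "j < n" for C :: "complex mat" and j
    using that by (intro eq_vecI) (auto simp: scalar_prod_right_unit)
  ultimately have "col A j = col B j" if "j < n" for j
    using that c by (metis unit_vec_carrier)
  then have "A = B" using c by (intro mat_col_eqI) auto
  then show ?thesis by (simp add: gh vw)
qed

lemma group_affine_unitary_group: "group (affine_unitary_group n)"
proof (rule groupI)
  show "\<one>\<^bsub>affine_unitary_group n\<^esub> \<in> carrier (affine_unitary_group n)"
    by (simp add: affine_unitary_group_def unitary_mat_one)
  fix g assume g: "g \<in> carrier (affine_unitary_group n)"
  then show "\<one>\<^bsub>affine_unitary_group n\<^esub> \<otimes>\<^bsub>affine_unitary_group n\<^esub> g = g"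
    by (auto simp: affine_unitary_group_def dest!: unitary_mat_carrier)
  obtain A w where Aw: "g = (A, w)" "unitary_mat n A" "w \<in> carrier_vec n"
    using g by (auto simp: affine_unitary_group_def)
  let ?B = "mat_adjoint A"
  have B: "unitary_mat n ?B" "?B \<in> carrier_mat n n" "?B * A = 1\<^sub>m n"
    using Aw(2) unitary_mat_adjoint[OF Aw(2)] by (auto simp: unitary_mat_def)
  then have "?B *\<^sub>v w + (- (?B *\<^sub>v w)) = 0\<^sub>v n" using Aw(3) by simp
  then show "\<exists>h\<in>carrier (affine_unitary_group n).
      h \<otimes>\<^bsub>affine_unitary_group n\<^esub> g = \<one>\<^bsub>affine_unitary_group n\<^esub>"
    using B Aw by (intro bexI[of _ "(?B, - (?B *\<^sub>v w))"]) (auto simp: affine_unitary_group_def)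
next
  fix g h assume "g \<in> carrier (affine_unitary_group n)" "h \<in> carrier (affine_unitary_group n)"
  then show "g \<otimes>\<^bsub>affine_unitary_group n\<^esub> h \<in> carrier (affine_unitary_group n)"
    by (auto simp: affine_unitary_group_def unitary_mat_mult dest: unitary_mat_carrier)
next
  fix g h k assume "g \<in> carrier (affine_unitary_group n)" "h \<in> carrier (affine_unitary_group n)"
    "k \<in> carrier (affine_unitary_group n)"
  then show "g \<otimes>\<^bsub>affine_unitary_group n\<^esub> h \<otimes>\<^bsub>affine_unitary_group n\<^esub> k =
      g \<otimes>\<^bsub>affine_unitary_group n\<^esub> (h \<otimes>\<^bsub>affine_unitary_group n\<^esub> k)"
    by (auto simp: affine_unitary_group_def mult_add_distrib_mat_vec[of _ n n]
      assoc_add_vec[of _ n] assoc_mult_mat_vec[of _ n n _ n] assoc_mult_mat[of _ n n _ n _ n]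
      dest!: unitary_mat_carrier)
qed

end

(* A unitary A is unitarily diagonalizable, and passing from A to its inverse conjugates the
   eigenvalues, so reversibility of A forces the spectrum to be closed under conjugation with
   multiplicities. Conversely, such a spectrum carries an involution s of the eigenbasis that
   pairs conjugate eigenvalues, and in the eigenbasis (A, w) is a product h k of two involutions
   (hence strongly reversible) whose linear parts are monomial matrices supported on s. The linear
   part of h has to be -1 on the fixed space of A. The translation part v of h is then determined
   by the requirement that k be an involution; this divides by 1 - cnj d, where d is an eigenvalue
   other than 1. *)
theory Submission
  imports Defs "Jordan_Normal_Form.Spectral_Radius"
begin

section \<open>Unitarity in terms of entries\<close>

text \<open>A one-sided inverse of a square matrix over a field is two-sided, so one of the two
  defining equations is enough.\<close>

lemma unitary_matI:
  assumes "A \<in> carrier_mat n n" "mat_adjoint A * A = 1\<^sub>m n"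
  shows "unitary_mat n A"
  using assms mat_mult_left_right_inverse[OF mat_adjoint_carrier[OF assms(1)] assms(1)]
  by (simp add: unitary_mat_def)

text \<open>This is orthonormality of the columns, written with sums over \<open>{..<n}\<close> so
  that the term at index 0 can be split off when a 1 by 1 block is peeled away.\<close>

lemma unitary_mat_iff_sum:
  assumes A: "A \<in> carrier_mat n n"
  shows "unitary_mat n A \<longleftrightarrow>
    (\<forall>i<n. \<forall>j<n. (\<Sum>k<n. cnj (A $$ (k, i)) * A $$ (k, j)) = (if i = j then 1 else 0))"
proof -
  have entry: "(mat_adjoint A * A) $$ (i, j) = (\<Sum>k<n. cnj (A $$ (k, i)) * A $$ (k, j))"
    if "i < n" "j < n" for i j
    using A that by (auto simp: scalar_prod_def lessThan_atLeast0 intro!: sum.cong)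
  have "mat_adjoint A * A = 1\<^sub>m n \<longleftrightarrow>
    (\<forall>i<n. \<forall>j<n. (mat_adjoint A * A) $$ (i, j) = (1\<^sub>m n) $$ (i, j))"
    using A by (simp add: mat_eq_iff del: index_mult_mat(1) index_one_mat(1))
  with entry show ?thesis
    using A unitary_matI[OF A] by (auto simp: unitary_mat_def)
qed

text \<open>Compare the diagonal entries in \<open>A * mat_adjoint A = 1\<^sub>m n\<close>. A row
  with one entry of modulus 1 therefore vanishes elsewhere.\<close>

lemma unitary_mat_row_norm:
  assumes "unitary_mat n A" "i < n"
  shows "(\<Sum>k<n. (cmod (A $$ (i, k)))\<^sup>2) = 1"
proof -
  have A: "A \<in> carrier_mat n n" and "(A * mat_adjoint A) $$ (i, i) = 1"
    using assms by (auto simp: unitary_mat_def)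
  moreover have "(A * mat_adjoint A) $$ (i, i) = (\<Sum>k<n. complex_of_real ((cmod (A $$ (i, k)))\<^sup>2))"
    using A assms(2)
    by (auto simp: scalar_prod_def lessThan_atLeast0 complex_norm_square simp del: of_real_power
        intro!: sum.cong)
  ultimately have "complex_of_real (\<Sum>k<n. (cmod (A $$ (i, k)))\<^sup>2) = 1" by simp
  then show ?thesis using of_real_eq_1_iff by blast
qed

section \<open>Unitary diagonalization\<close>

text \<open>Complete \<open>v\<close> to a basis, apply Gram-Schmidt, which leaves the first vector
  \<open>v\<close> unchanged, and divide each resulting vector by its norm.\<close>

lemma unitary_mat_first_column:
  assumes v: "v \<in> carrier_vec n" "v \<noteq> 0\<^sub>v n"
  obtains W c where "unitary_mat n W" "col W 0 = c \<cdot>\<^sub>v v"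
proof -
  interpret cof_vec_space n "TYPE(complex)" .
  define ws where "ws = gram_schmidt n (basis_completion v)"
  note b = basis_completion[OF v]
  note g = gram_schmidt_result[OF b(2) b(4) b(5) ws_def]
  have n: "n > 0" using v by (cases n) (auto intro: eq_vecI)
  have "basis_completion v = v # tl (basis_completion v)"
    using b(6,7) n by (cases "basis_completion v") auto
  then have hd: "hd ws = v" unfolding ws_def by (metis gram_schmidt_hd v(1))
  have len: "length ws = n" using g(4) b(6) by simp
  have ws0: "ws ! 0 = v" using hd len n by (cases ws) auto
  have ws: "ws ! i \<in> carrier_vec n" if "i < n" for i using g(3) len that by auto
  define r where "r i = sqrt (\<Sum>k<n. (cmod (ws ! i $ k))\<^sup>2)" for i
  define W where "W = Matrix.mat n n (\<lambda>(i, j). ws ! j $ i / complex_of_real (r j))"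
  have W: "W \<in> carrier_mat n n" by (simp add: W_def)
  have ip: "(\<Sum>k<n. cnj (ws ! i $ k) * ws ! j $ k) = ws ! j \<bullet>c ws ! i" if "i < n" "j < n" for i j
    using ws[OF that(1)] ws[OF that(2)]
    by (auto simp: scalar_prod_def lessThan_atLeast0 mult.commute intro!: sum.cong)
  \<comment> \<open>Besides orthogonality this says that the product of \<open>ws ! i\<close> with
    itself is nonzero. Hence no \<open>r i\<close> vanishes and the columns of \<open>W\<close> are
    indeed normalized.\<close>
  have orth: "(ws ! j \<bullet>c ws ! i = 0) = (i \<noteq> j)" if "i < n" "j < n" for i j
    using corthogonalD[OF g(2), of j i] that len by auto
  have rr: "ws ! i \<bullet>c ws ! i = complex_of_real (r i * r i)" if "i < n" for i
  proof -
    have "r i * r i = (\<Sum>k<n. (cmod (ws ! i $ k))\<^sup>2)"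
      unfolding r_def by (simp add: sum_nonneg)
    then show ?thesis
      unfolding ip[OF that that, symmetric]
      by (simp add: complex_norm_square mult.commute del: of_real_power)
  qed
  have "(\<Sum>k<n. cnj (W $$ (k, i)) * W $$ (k, j)) = (if i = j then 1 else 0)"
    if ij: "i < n" "j < n" for i j
  proof -
    have "(\<Sum>k<n. cnj (W $$ (k, i)) * W $$ (k, j)) =
      (\<Sum>k<n. cnj (ws ! i $ k) * ws ! j $ k) / complex_of_real (r i * r j)"
      using ij unfolding sum_divide_distrib by (intro sum.cong) (auto simp: W_def)
    also have "\<dots> = (if i = j then 1 else 0)"
      using orth[OF ij] rr[OF ij(1)] ip[OF ij] by (cases "i = j") auto
    finally show ?thesis .
  qed
  then have "unitary_mat n W" using unitary_mat_iff_sum[OF W] by blast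
  moreover have "col W 0 = (1 / complex_of_real (r 0)) \<cdot>\<^sub>v v"
    using n v by (intro eq_vecI) (auto simp: W_def ws0)
  ultimately show ?thesis using that by blast
qed

text \<open>Induction on the dimension. In an orthonormal basis that starts with an eigenvector, the
  first column of a unitary matrix has a single nonzero entry, of modulus 1. The norm of the first
  row then clears the rest of that row, and the remaining block is unitary of smaller size.\<close>

lemma unitary_mat_diagonalizable:
  assumes "unitary_mat n A"
  shows "\<exists>U d. unitary_mat n U \<and> A * U = U * mat_diag n d"
  using assms
proof (induction n arbitrary: A)
  case 0
  then show ?case
    by (intro exI[of _ "1\<^sub>m 0"] exI)
       (auto simp: unitary_mat_def mat_adjoint_one mat_diag_def intro!: eq_matI)
next
  case (Suc m)
  let ?n = "Suc m"
  note A = unitary_mat_carrier[OF Suc.prems]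
  obtain e v where ev: "eigenvector A v e"
    using spectrum_non_empty[OF A] by (auto simp: spectrum_def eigenvalue_def)
  then have v: "v \<in> carrier_vec ?n" "v \<noteq> 0\<^sub>v ?n" and Av: "A *\<^sub>v v = e \<cdot>\<^sub>v v"
    using A by (auto simp: eigenvector_def)
  obtain W c where uW: "unitary_mat ?n W" and col0: "col W 0 = c \<cdot>\<^sub>v v"
    using unitary_mat_first_column[OF v] .
  note W = unitary_mat_carrier[OF uW] and W' = mat_adjoint_carrier[OF unitary_mat_carrier[OF uW]]
  have WW: "mat_adjoint W * W = 1\<^sub>m ?n" "W * mat_adjoint W = 1\<^sub>m ?n"
    using uW by (auto simp: unitary_mat_def)
  \<comment> \<open>\<open>T\<close> is \<open>A\<close> in the basis of the columns of
    \<open>W\<close>. Its first column is \<open>e\<close> times the first unit vector because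
    \<open>col W 0\<close> is an eigenvector.\<close>
  define T where "T = mat_adjoint W * (A * W)"
  have uT: "unitary_mat ?n T"
    unfolding T_def by (intro unitary_mat_mult unitary_mat_adjoint uW Suc.prems)
  note T = unitary_mat_carrier[OF uT]
  have AW: "A *\<^sub>v col W 0 = e \<cdot>\<^sub>v col W 0"
    using A v by (simp add: col0 mult_mat_vec[of _ ?n ?n] Av smult_smult_assoc mult.commute)
  have c0: "col W 0 \<in> carrier_vec ?n" by (rule col_carrier_vec[OF _ W]) simp
  have "col T 0 = mat_adjoint W *\<^sub>v col (A * W) 0"
    unfolding T_def by (rule col_mult2[OF W' mult_carrier_mat[OF A W]]) simp
  also have "col (A * W) 0 = e \<cdot>\<^sub>v col W 0"
    unfolding AW[symmetric] by (rule col_mult2[OF A W]) simp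
  also have "mat_adjoint W *\<^sub>v \<dots> = e \<cdot>\<^sub>v (mat_adjoint W *\<^sub>v col W 0)"
    by (rule mult_mat_vec[OF W' c0])
  also have "mat_adjoint W *\<^sub>v col W 0 = col (mat_adjoint W * W) 0"
    by (rule col_mult2[OF W' W, symmetric]) simp
  finally have colT0: "col T 0 = e \<cdot>\<^sub>v col (mat_adjoint W * W) 0" .
  have colT: "T $$ (i, 0) = (if i = 0 then e else 0)" if "i < ?n" for i
  proof -
    have "T $$ (i, 0) = col T 0 $ i" using T that by simp
    also have "\<dots> = (if i = 0 then e else 0)"
      unfolding colT0 WW using that by simp
    finally show ?thesis .
  qed
  have "cnj e * e = 1"
  proof -
    have "(\<Sum>k<?n. cnj (T $$ (k, 0)) * T $$ (k, 0)) = 1"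
      using uT unfolding unitary_mat_iff_sum[OF T] by auto
    then show ?thesis unfolding sum.lessThan_Suc_shift by (simp add: colT)
  qed
  then have e: "cmod e = 1"
    by (metis abs_norm_cancel abs_square_eq_1 complex_mod_mult_cnj mult.commute norm_one power2_eq_square)
  \<comment> \<open>Row 0 has norm 1, and its entry \<open>e\<close> already accounts for all of
    it.\<close>
  have "(\<Sum>k<m. (cmod (T $$ (0, Suc k)))\<^sup>2) = 0"
    using unitary_mat_row_norm[OF uT, of 0] unfolding sum.lessThan_Suc_shift by (simp add: colT e)
  then have rowT: "T $$ (0, Suc k) = 0" if "k < m" for k
    using that by (subst (asm) sum_nonneg_eq_0_iff) auto
  define B where "B = Matrix.mat m m (\<lambda>(i, j). T $$ (Suc i, Suc j))"
  have B: "B \<in> carrier_mat m m" by (simp add: B_def)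
  \<comment> \<open>As row 0 of \<open>T\<close> is zero beyond the corner, the index
    \<open>k = 0\<close> contributes nothing to the products of the later columns.\<close>
  have "unitary_mat m B"
    unfolding unitary_mat_iff_sum[OF B]
  proof (intro allI impI)
    fix i j assume ij: "i < m" "j < m"
    then have "(\<Sum>k<?n. cnj (T $$ (k, Suc i)) * T $$ (k, Suc j)) = (if i = j then 1 else 0)"
      using uT unfolding unitary_mat_iff_sum[OF T] by auto
    then show "(\<Sum>k<m. cnj (B $$ (k, i)) * B $$ (k, j)) = (if i = j then 1 else 0)"
      using ij unfolding sum.lessThan_Suc_shift by (simp add: rowT B_def)
  qed
  then obtain V d where uV: "unitary_mat m V" and BV: "B * V = V * mat_diag m d"
    using Suc.IH by blast
  note V = unitary_mat_carrier[OF uV]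
  \<comment> \<open>\<open>V1\<close> is the block sum of the 1 by 1 identity and \<open>V\<close>;
    correspondingly \<open>d1\<close> puts \<open>e\<close> in front of \<open>d\<close>.\<close>
  define V1 where "V1 = Matrix.mat ?n ?n (\<lambda>(i, j). case (i, j) of
      (0, 0) \<Rightarrow> 1 | (Suc i', Suc j') \<Rightarrow> V $$ (i', j') | _ \<Rightarrow> 0)"
  define d1 where "d1 = case_nat e d"
  have V1: "V1 \<in> carrier_mat ?n ?n" by (simp add: V1_def)
  have V1_simps: "V1 $$ (0, 0) = 1" "k < m \<Longrightarrow> V1 $$ (0, Suc k) = 0" "k < m \<Longrightarrow> V1 $$ (Suc k, 0) = 0"
    "k < m \<Longrightarrow> l < m \<Longrightarrow> V1 $$ (Suc k, Suc l) = V $$ (k, l)" for k l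
    by (simp_all add: V1_def)
  have uV1: "unitary_mat ?n V1"
    unfolding unitary_mat_iff_sum[OF V1]
  proof (intro allI impI)
    fix i j assume "i < ?n" "j < ?n"
    moreover have "(\<Sum>k<m. cnj (V $$ (k, i)) * V $$ (k, j)) = (if i = j then 1 else 0)"
      if "i < m" "j < m" for i j
      using uV that unfolding unitary_mat_iff_sum[OF V] by auto
    ultimately show "(\<Sum>k<?n. cnj (V1 $$ (k, i)) * V1 $$ (k, j)) = (if i = j then 1 else 0)"
      unfolding sum.lessThan_Suc_shift by (cases i; cases j) (auto simp: V1_simps)
  qed
  have TV: "T * V1 = V1 * mat_diag ?n d1"
  proof (rule eq_matI)
    fix i j assume "i < dim_row (V1 * mat_diag ?n d1)" "j < dim_col (V1 * mat_diag ?n d1)"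
    then have ij: "i < ?n" "j < ?n" using V1 by (auto simp: mat_diag_def)
    have "(\<Sum>k<m. B $$ (i, k) * V $$ (k, j)) = V $$ (i, j) * d j" if "i < m" "j < m" for i j
      using arg_cong[OF BV, where f = "\<lambda>X. X $$ (i, j)"] that B V
      unfolding mat_diag_mult_right[OF V]
      by (auto simp: scalar_prod_def lessThan_atLeast0)
    then have *: "(\<Sum>k<m. T $$ (Suc i, Suc k) * V $$ (k, j)) = V $$ (i, j) * d j"
      if "i < m" "j < m" for i j
      using that by (simp add: B_def)
    have "(T * V1) $$ (i, j) = (\<Sum>k<?n. T $$ (i, k) * V1 $$ (k, j))"
      using ij T V1 by (auto simp: scalar_prod_def lessThan_atLeast0)
    also have "\<dots> = V1 $$ (i, j) * d1 j"
      using ij unfolding sum.lessThan_Suc_shift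
      by (cases i; cases j) (auto simp: V1_simps d1_def colT rowT *)
    finally show "(T * V1) $$ (i, j) = (V1 * mat_diag ?n d1) $$ (i, j)"
      using ij unfolding mat_diag_mult_right[OF V1] by simp
  qed (use T V1 in \<open>auto simp: mat_diag_def\<close>)
  have "A * (W * V1) = (W * mat_adjoint W) * (A * W) * V1"
    using A W V1 by (simp add: WW assoc_mult_mat[of _ ?n ?n _ ?n _ ?n])
  also have "\<dots> = W * (T * V1)"
    unfolding T_def using A W W' V1
    by (simp add: assoc_mult_mat[of _ ?n ?n _ ?n _ ?n])
  also have "\<dots> = (W * V1) * mat_diag ?n d1"
    unfolding TV using W V1 by (simp add: assoc_mult_mat[of _ ?n ?n _ ?n _ ?n])
  finally show ?case using unitary_mat_mult[OF uW uV1] by blast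
qed

section \<open>Reversibility and group homomorphisms\<close>

text \<open>A homomorphism respects products, inverses and the unit, so the image of the reversing
  element reverses \<open>f g\<close>. This is applied to the projection onto the linear part and to
  conjugations.\<close>

lemma strongly_reversible_hom:
  assumes "group G" "group H" "f \<in> hom G H" "g \<in> carrier G" "strongly_reversible G g"
  shows "strongly_reversible H (f g)"
proof -
  interpret group_hom G H f
    using assms by (simp add: group_hom_def group_hom_axioms_def)
  obtain h where h: "h \<in> carrier G" "h \<otimes>\<^bsub>G\<^esub> g \<otimes>\<^bsub>G\<^esub> inv\<^bsub>G\<^esub> h = inv\<^bsub>G\<^esub> g" "h \<otimes>\<^bsub>G\<^esub> h = \<one>\<^bsub>G\<^esub>"
    using assms(5) by (auto simp: strongly_reversible_def)
  have "f h \<otimes>\<^bsub>H\<^esub> f g \<otimes>\<^bsub>H\<^esub> inv\<^bsub>H\<^esub> f h = inv\<^bsub>H\<^esub> f g"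
    using arg_cong[OF h(2), of f] h(1) assms(4) by simp
  moreover have "f h \<otimes>\<^bsub>H\<^esub> f h = \<one>\<^bsub>H\<^esub>"
    using arg_cong[OF h(3), of f] h(1) by simp
  ultimately show ?thesis using h(1) by (auto simp: strongly_reversible_def)
qed

lemma reversible_hom:
  assumes "group G" "group H" "f \<in> hom G H" "g \<in> carrier G" "reversible G g"
  shows "reversible H (f g)"
proof -
  interpret group_hom G H f
    using assms by (simp add: group_hom_def group_hom_axioms_def)
  obtain h where h: "h \<in> carrier G" "h \<otimes>\<^bsub>G\<^esub> g \<otimes>\<^bsub>G\<^esub> inv\<^bsub>G\<^esub> h = inv\<^bsub>G\<^esub> g"
    using assms(5) by (auto simp: reversible_def)
  have "f h \<otimes>\<^bsub>H\<^esub> f g \<otimes>\<^bsub>H\<^esub> inv\<^bsub>H\<^esub> f h = inv\<^bsub>H\<^esub> f g"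
    using arg_cong[OF h(2), of f] h(1) assms(4) by simp
  then show ?thesis using h(1) by (auto simp: reversible_def)
qed

lemma strongly_reversible_imp_reversible: "strongly_reversible G g \<Longrightarrow> reversible G g"
  by (auto simp: strongly_reversible_def reversible_def)

text \<open>Conjugating \<open>h \<otimes> k\<close> by \<open>h\<close> gives
  \<open>k \<otimes> h\<close>, which is the inverse of \<open>h \<otimes> k\<close> since both
  factors are involutions.\<close>

lemma (in group) strongly_reversible_mult_involutions:
  assumes "h \<in> carrier G" "k \<in> carrier G" "h \<otimes> h = \<one>" "k \<otimes> k = \<one>"
  shows "strongly_reversible G (h \<otimes> k)"
proof -
  have inv: "inv h = h" "inv k = k" using assms by (simp_all add: inv_equality)
  have "h \<otimes> (h \<otimes> k) \<otimes> inv h = (h \<otimes> h) \<otimes> k \<otimes> h"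
    using assms(1,2) by (simp add: inv m_assoc)
  also have "\<dots> = inv (h \<otimes> k)"
    using assms by (simp add: inv inv_mult_group)
  finally show ?thesis using assms by (auto simp: strongly_reversible_def)
qed

lemma (in group) conjugation_hom:
  assumes "u \<in> carrier G"
  shows "(\<lambda>x. u \<otimes> x \<otimes> inv u) \<in> hom G G"
proof (rule homI)
  fix x y assume xy: "x \<in> carrier G" "y \<in> carrier G"
  have "u \<otimes> x \<otimes> inv u \<otimes> (u \<otimes> y \<otimes> inv u) = u \<otimes> x \<otimes> (inv u \<otimes> u) \<otimes> (y \<otimes> inv u)"
    using assms xy by (simp only: m_assoc m_closed inv_closed)
  then show "u \<otimes> (x \<otimes> y) \<otimes> inv u = u \<otimes> x \<otimes> inv u \<otimes> (u \<otimes> y \<otimes> inv u)"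
    using assms xy by (simp add: m_assoc)
qed (use assms in simp)

lemma fst_hom: "fst \<in> hom (affine_unitary_group n) (unitary_group n)"
  by (auto simp: hom_def affine_unitary_group_def unitary_group_def)

lemma inv_unitary_group:
  assumes "unitary_mat n A"
  shows "inv\<^bsub>unitary_group n\<^esub> A = mat_adjoint A"
proof -
  interpret group "unitary_group n" by (rule group_unitary_group)
  show ?thesis
    using assms unitary_mat_adjoint[OF assms]
    by (intro inv_equality) (auto simp: unitary_group_def unitary_mat_def)
qed

section \<open>Characteristic polynomial and eigenvalue multiplicities\<close>

text \<open>The order is additive on nonzero products, and a linear factor has order 1 at its root
  and 0 elsewhere.\<close>

lemma order_prod_linear:
  fixes d :: "'i \<Rightarrow> 'a :: field"
  assumes "finite I"
  shows "Polynomial.order a (\<Prod>i\<in>I. [:- d i, 1:]) = card {i \<in> I. d i = a}"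
  using assms
proof (induction I rule: finite_induct)
  case (insert i I)
  have "(\<Prod>i\<in>I. [:- d i, 1:]) \<noteq> 0" using insert.hyps by (simp add: prod_zero_iff)
  then have "Polynomial.order a (\<Prod>i\<in>insert i I. [:- d i, 1:]) =
      (if d i = a then 1 else 0) + card {i \<in> I. d i = a}"
    using insert by (simp add: order_mult order_linear' del: mult_pCons_left)
  also have "{j \<in> insert i I. d j = a} = (if d i = a then insert i {i \<in> I. d i = a} else {i \<in> I. d i = a})"
    by auto
  then have "(if d i = a then 1 else 0) + card {i \<in> I. d i = a} = card {j \<in> insert i I. d j = a}"
    using insert.hyps by simp
  finally show ?case .
qed simp

lemma char_poly_unitary_diag:
  assumes "unitary_mat n U"
  shows "char_poly (U * mat_diag n d * mat_adjoint U) = (\<Prod>i<n. [:- d i, 1:])"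
proof -
  have U: "U \<in> carrier_mat n n" "mat_adjoint U \<in> carrier_mat n n"
    using assms by (auto simp: unitary_mat_carrier unitary_mat_adjoint)
  have "similar_mat_wit (U * mat_diag n d * mat_adjoint U) (mat_diag n d) U (mat_adjoint U)"
    using assms U by (intro similar_mat_witI[of _ _ n] mult_carrier_mat[of _ n n])
       (simp_all add: unitary_mat_def)
  then have "similar_mat (U * mat_diag n d * mat_adjoint U) (mat_diag n d)"
    unfolding similar_mat_def by blast
  then have "char_poly (U * mat_diag n d * mat_adjoint U) = char_poly (mat_diag n d)"
    by (rule char_poly_similar)
  also have "\<dots> = (\<Prod>a\<leftarrow>diag_mat (mat_diag n d). [:- a, 1:])"
    by (rule char_poly_upper_triangular[of _ n]) (auto simp: mat_diag_def)
  also have "\<dots> = (\<Prod>i<n. [:- d i, 1:])"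
  proof -
    have "diag_mat (mat_diag n d) = map d [0..<n]"
      by (auto simp: diag_mat_def mat_diag_def)
    then show ?thesis
      using prod.distinct_set_conv_list[of "[0..<n]" "\<lambda>i. [:- d i, 1:]"]
      by (simp add: o_def lessThan_atLeast0)
  qed
  finally show ?thesis .
qed

text \<open>From \<open>A * U = U * mat_diag n d\<close> the diagonal matrix equals
  \<open>mat_adjoint U * (A * U)\<close>. It is thus unitary, and its row norms give the moduli of
  the eigenvalues.\<close>

lemma unitary_mat_spectral:
  assumes "unitary_mat n A"
  obtains U d where "unitary_mat n U" "A = U * mat_diag n d * mat_adjoint U"
    "unitary_mat n (mat_diag n d)" "\<forall>i<n. cmod (d i) = 1"
proof -
  obtain U d where U: "unitary_mat n U" and AU: "A * U = U * mat_diag n d"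
    using unitary_mat_diagonalizable[OF assms] by blast
  note Uc = unitary_mat_carrier[OF U] and Ac = unitary_mat_carrier[OF assms]
  note Ua = mat_adjoint_carrier[OF Uc]
  have UU: "mat_adjoint U * U = 1\<^sub>m n" "U * mat_adjoint U = 1\<^sub>m n"
    using U by (auto simp: unitary_mat_def)
  have "A = A * (U * mat_adjoint U)" using Ac by (simp add: UU)
  also have "\<dots> = (A * U) * mat_adjoint U"
    using Ac Uc Ua by (simp add: assoc_mult_mat[of _ n n _ n _ n])
  finally have A: "A = U * mat_diag n d * mat_adjoint U" by (simp add: AU)
  have "mat_adjoint U * (A * U) = (mat_adjoint U * U) * mat_diag n d"
    using Uc Ua by (simp add: AU assoc_mult_mat[of _ n n _ n _ n])
  then have "mat_diag n d = mat_adjoint U * (A * U)"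
    by (simp add: UU left_mult_one_mat[OF mat_diag_dim])
  then have D: "unitary_mat n (mat_diag n d)"
    using U assms by (simp add: unitary_mat_mult unitary_mat_adjoint)
  have "cmod (d i) = 1" if "i < n" for i
  proof -
    have "(\<Sum>k<n. (cmod (mat_diag n d $$ (i, k)))\<^sup>2) = (\<Sum>k<n. if k = i then (cmod (d i))\<^sup>2 else 0)"
      using that by (intro sum.cong) (auto simp: mat_diag_def)
    with unitary_mat_row_norm[OF D that] that
    have "(cmod (d i))\<^sup>2 = 1" by simp
    then show ?thesis by (metis abs_norm_cancel abs_square_eq_1)
  qed
  with U A D that show ?thesis by blast
qed

lemma mat_adjoint_unitary_diag:
  assumes "U \<in> carrier_mat n n"
  shows "mat_adjoint (U * mat_diag n d * mat_adjoint U) = U * mat_diag n (\<lambda>i. cnj (d i)) * mat_adjoint U"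
proof -
  have D: "mat_adjoint (mat_diag n d) = mat_diag n (\<lambda>i. cnj (d i))"
    by (rule eq_matI) (auto simp: mat_diag_def)
  have "dim_row (mat_diag n d) = n" "dim_col (mat_diag n d) = n"
    by (auto simp: mat_diag_def)
  then show ?thesis
    using assms mat_adjoint_carrier[OF assms]
    by (simp add: mat_adjoint_mult mat_adjoint_adjoint D assoc_mult_mat[of _ n n _ n _ n])
qed

text \<open>On the unit circle the inverse is the conjugate, and multiplicities count indices. The
  exceptional values 1 and -1 are their own conjugates, so the equation of cardinalities holds there
  anyway.\<close>

lemma card_roots_conj_iff_self_dual:
  assumes U: "unitary_mat n U" and d: "\<forall>i<n. cmod (d i) = 1"
  shows "self_dual (char_poly (U * mat_diag n d * mat_adjoint U)) \<longleftrightarrow>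
    (\<forall>a. card {i \<in> {..<n}. d i = cnj a} = card {i \<in> {..<n}. d i = a})"
proof -
  define p where "p = (\<Prod>i<n. [:- d i, 1:])"
  have p0: "p \<noteq> 0" unfolding p_def by (simp add: prod_zero_iff)
  have ord: "Polynomial.order a p = card {i \<in> {..<n}. d i = a}" for a
    unfolding p_def by (simp add: order_prod_linear)
  have root: "poly p a = 0 \<longleftrightarrow> card {i \<in> {..<n}. d i = a} \<noteq> 0" for a
    using order_root[of p a] p0 by (simp add: ord)
  have norm: "cmod a = 1" if "poly p a = 0" for a
    using that d unfolding p_def by (auto simp: poly_prod)
  have inv: "inverse a = cnj a" if "cmod a = 1" for a
    using that complex_norm_square[of a] by (intro inverse_unique) simp
  have "self_dual p \<longleftrightarrow> (\<forall>a. card {i \<in> {..<n}. d i = cnj a} = card {i \<in> {..<n}. d i = a})"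
  proof
    assume sd: "self_dual p"
    have *: "card {i \<in> {..<n}. d i = cnj a} = card {i \<in> {..<n}. d i = a}" if "poly p a = 0" for a
    proof (cases "a = 1 \<or> a = -1")
      case False
      then show ?thesis
        using sd that inv[OF norm[OF that]] unfolding self_dual_def ord by auto
    qed auto
    show "\<forall>a. card {i \<in> {..<n}. d i = cnj a} = card {i \<in> {..<n}. d i = a}"
    proof
      fix a
      \<comment> \<open>\<open>self_dual\<close> constrains roots only. If \<open>cnj a\<close> is a
        root, the equation at \<open>cnj a\<close> is read backwards; if neither is a root, both
        counts are 0.\<close>
      consider "poly p a = 0" | "poly p (cnj a) = 0" | "poly p a \<noteq> 0" "poly p (cnj a) \<noteq> 0"
        by blast
      then show "card {i \<in> {..<n}. d i = cnj a} = card {i \<in> {..<n}. d i = a}"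
      proof cases
        case 2
        then show ?thesis using *[of "cnj a"] by simp
      next
        case 3
        then show ?thesis unfolding root by linarith
      qed (rule *)
    qed
  next
    assume *: "\<forall>a. card {i \<in> {..<n}. d i = cnj a} = card {i \<in> {..<n}. d i = a}"
    show "self_dual p"
      unfolding self_dual_def
    proof (intro allI impI)
      fix a assume "poly p a = 0 \<and> a \<noteq> 1 \<and> a \<noteq> -1"
      then have a: "poly p a = 0" by blast
      show "poly p (inverse a) = 0 \<and> Polynomial.order (inverse a) p = Polynomial.order a p"
        using a unfolding inv[OF norm[OF a]] ord root *[rule_format] by simp
    qed
  qed
  then show ?thesis unfolding char_poly_unitary_diag[OF U] p_def .
qed

section \<open>From reversibility to a self-dual polynomial\<close>

text \<open>The reversing element makes \<open>A\<close> similar to its inverse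
  \<open>mat_adjoint A\<close>, so both have the same characteristic polynomial, while the
  eigenvalues of the latter are the conjugates of those of \<open>A\<close>.\<close>

lemma reversible_imp_self_dual:
  assumes A: "unitary_mat n A" and rev: "reversible (unitary_group n) A"
  shows "self_dual (char_poly A)"
proof -
  obtain U d where U: "unitary_mat n U" and AU: "A = U * mat_diag n d * mat_adjoint U"
    and d: "\<forall>i<n. cmod (d i) = 1"
    using unitary_mat_spectral[OF A] by blast
  obtain h where "h \<in> carrier (unitary_group n)" and conj: "h \<otimes>\<^bsub>unitary_group n\<^esub> A
      \<otimes>\<^bsub>unitary_group n\<^esub> inv\<^bsub>unitary_group n\<^esub> h = inv\<^bsub>unitary_group n\<^esub> A"
    using rev by (auto simp: reversible_def)
  then have uh: "unitary_mat n h" by (simp add: unitary_group_def)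
  then have h: "unitary_mat n h" "h * A * mat_adjoint h = mat_adjoint A"
    using conj unfolding inv_unitary_group[OF uh] inv_unitary_group[OF A]
    by (simp_all add: unitary_group_def)
  have "similar_mat_wit (mat_adjoint A) A h (mat_adjoint h)"
    using h A by (intro similar_mat_witI[of _ _ n])
      (auto simp: unitary_mat_def mat_adjoint_carrier)
  then have "char_poly (mat_adjoint A) = char_poly A"
    by (intro char_poly_similar) (auto simp: similar_mat_def)
  then have "(\<Prod>i<n. [:- cnj (d i), 1:]) = (\<Prod>i<n. [:- d i, 1:])"
    unfolding AU mat_adjoint_unitary_diag[OF unitary_mat_carrier[OF U]] char_poly_unitary_diag[OF U] .
  then have "card {i \<in> {..<n}. cnj (d i) = a} = card {i \<in> {..<n}. d i = a}" for a
    by (metis finite_lessThan order_prod_linear)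
  moreover have "cnj x = a \<longleftrightarrow> x = cnj a" for x a by auto
  ultimately show ?thesis
    unfolding AU card_roots_conj_iff_self_dual[OF U d] by simp
qed

section \<open>Pairing conjugate eigenvalues\<close>

text \<open>Conjugate fibres of \<open>d\<close> have equal size, hence are in bijection. The chosen
  bijection is used on the upper half plane and its inverse on the lower one, which makes
  \<open>s\<close> an involution. Real values are left alone, so that \<open>s\<close> fixes every
  index with eigenvalue 1.\<close>

lemma conj_involution:
  fixes d :: "'i \<Rightarrow> complex"
  assumes fin: "finite I"
    and card: "\<And>a. card {i \<in> I. d i = cnj a} = card {i \<in> I. d i = a}"
  obtains s where "\<And>i. i \<in> I \<Longrightarrow> s i \<in> I" "\<And>i. i \<in> I \<Longrightarrow> s (s i) = i"
    "\<And>i. i \<in> I \<Longrightarrow> d (s i) = cnj (d i)" "\<And>i. d i \<in> \<real> \<Longrightarrow> s i = i"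
proof -
  define F where "F a = {i \<in> I. d i = a}" for a
  have "\<exists>f. bij_betw f (F a) (F (cnj a))" for a
    using fin card[of a] unfolding F_def by (intro finite_same_card_bij) auto
  then obtain f where f: "\<And>a. bij_betw (f a) (F a) (F (cnj a))" by metis
  \<comment> \<open>\<open>f (cnj a)\<close> maps \<open>F (cnj a)\<close> onto \<open>F a\<close>,
    so its inverse runs from \<open>F a\<close> to \<open>F (cnj a)\<close>, just as
    \<open>f a\<close> does.\<close>
  define g where "g a = inv_into (F (cnj a)) (f (cnj a))" for a
  have g: "bij_betw (g a) (F a) (F (cnj a))" for a
    using bij_betw_inv_into[OF f[of "cnj a"]] by (simp add: g_def)
  define s where "s i = (if Im (d i) = 0 then i else if Im (d i) > 0 then f (d i) i else g (d i) i)" for i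
  have F: "i \<in> F (d i)" if "i \<in> I" for i using that by (simp add: F_def)
  have s1: "s i \<in> F (cnj (d i))" if "i \<in> I" for i
  proof (cases "Im (d i) = 0")
    case True
    then have "cnj (d i) = d i" by (simp add: complex_eq_iff)
    then show ?thesis using F[OF that] True by (simp add: s_def)
  next
    case False
    then show ?thesis
      using bij_betw_apply[OF f F[OF that]] bij_betw_apply[OF g F[OF that]] by (simp add: s_def)
  qed
  then have ds: "s i \<in> I" "d (s i) = cnj (d i)" if "i \<in> I" for i
    using that unfolding F_def by auto
  have "s (s i) = i" if i: "i \<in> I" for i
  proof -
    consider "Im (d i) = 0" | "Im (d i) > 0" | "Im (d i) < 0" by linarith
    then show ?thesis
    proof cases
      case 1
      then show ?thesis by (simp add: s_def)
    next
      case 2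
      then have "s (s i) = g (cnj (d i)) (f (d i) i)"
        using ds(2)[OF i] by (simp add: s_def)
      also have "\<dots> = i"
        using bij_betw_inv_into_left[OF f F[OF i]] by (simp add: g_def)
      finally show ?thesis .
    next
      case 3
      then have "s (s i) = f (cnj (d i)) (g (d i) i)"
        using ds(2)[OF i] by (simp add: s_def)
      also have "\<dots> = i"
        unfolding g_def using bij_betw_inv_into_right[OF f, of i "cnj (d i)"] F[OF i] by simp
      finally show ?thesis .
    qed
  qed
  moreover have "s i = i" if "d i \<in> \<real>" for i
    using that by (simp add: s_def complex_is_Real_iff)
  ultimately show ?thesis using ds that by blast
qed

section \<open>Monomial matrices and affine involutions\<close>

text \<open>A weighted permutation matrix when \<open>s\<close> permutes the indices below
  \<open>n\<close>, described by its rows.\<close>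

definition monomial_mat :: "nat \<Rightarrow> (nat \<Rightarrow> complex) \<Rightarrow> (nat \<Rightarrow> nat) \<Rightarrow> complex mat" where
  "monomial_mat n c s = Matrix.mat n n (\<lambda>(i, j). if j = s i then c i else 0)"

lemma monomial_mat_carrier [simp]: "monomial_mat n c s \<in> carrier_mat n n"
  by (simp add: monomial_mat_def)

lemma monomial_mat_mult_vec:
  assumes "x \<in> carrier_vec n" "\<And>i. i < n \<Longrightarrow> s i < n"
  shows "monomial_mat n c s *\<^sub>v x = vec n (\<lambda>i. c i * x $ s i)"
proof (rule eq_vecI)
  fix i assume "i < dim_vec (vec n (\<lambda>i. c i * x $ s i))"
  then have i: "i < n" by simp
  have "(monomial_mat n c s *\<^sub>v x) $ i = (\<Sum>j = 0..<n. (if j = s i then c i else 0) * x $ j)"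
    using i assms(1) by (simp add: monomial_mat_def scalar_prod_def)
  also have "\<dots> = (\<Sum>j = 0..<n. if j = s i then c i * x $ j else 0)"
    by (intro sum.cong) auto
  also have "\<dots> = vec n (\<lambda>i. c i * x $ s i) $ i"
    using i assms(2)[OF i] by simp
  finally show "(monomial_mat n c s *\<^sub>v x) $ i = vec n (\<lambda>i. c i * x $ s i) $ i" .
qed (simp add: monomial_mat_def)

text \<open>Row \<open>i\<close> of the left factor selects row \<open>s i\<close> of the right one;
  hence \<open>b (s i)\<close> and the order \<open>t \<circ> s\<close>.\<close>

lemma monomial_mat_mult:
  assumes "\<And>i. i < n \<Longrightarrow> s i < n"
  shows "monomial_mat n c s * monomial_mat n b t = monomial_mat n (\<lambda>i. c i * b (s i)) (t \<circ> s)"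
proof (rule eq_matI)
  fix i j
  assume "i < dim_row (monomial_mat n (\<lambda>i. c i * b (s i)) (t \<circ> s))"
    "j < dim_col (monomial_mat n (\<lambda>i. c i * b (s i)) (t \<circ> s))"
  then have ij: "i < n" "j < n" by (simp_all add: monomial_mat_def)
  have "(monomial_mat n c s * monomial_mat n b t) $$ (i, j) =
      (\<Sum>k = 0..<n. (if k = s i then c i else 0) * (if j = t k then b k else 0))"
    using ij by (simp add: monomial_mat_def scalar_prod_def)
  also have "\<dots> = (\<Sum>k = 0..<n. if k = s i then (if j = t k then c i * b k else 0) else 0)"
    by (intro sum.cong) auto
  also have "\<dots> = monomial_mat n (\<lambda>i. c i * b (s i)) (t \<circ> s) $$ (i, j)"
    using ij assms[OF ij(1)] by (simp add: monomial_mat_def)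
  finally show "(monomial_mat n c s * monomial_mat n b t) $$ (i, j) =
      monomial_mat n (\<lambda>i. c i * b (s i)) (t \<circ> s) $$ (i, j)" .
qed (simp_all add: monomial_mat_def)

lemma monomial_mat_eq_diag:
  assumes "\<And>i. i < n \<Longrightarrow> s i = i" "\<And>i. i < n \<Longrightarrow> c i = d i"
  shows "monomial_mat n c s = mat_diag n d"
  using assms by (intro eq_matI) (auto simp: monomial_mat_def mat_diag_def)

text \<open>The condition on \<open>c (s i)\<close> makes the matrix Hermitian, and with modulus 1
  its square is the identity, so it is also unitary. The condition on \<open>x\<close> says that the
  translation part of the square vanishes.\<close>

lemma affine_monomial_involution:
  assumes s: "\<And>i. i < n \<Longrightarrow> s i < n" "\<And>i. i < n \<Longrightarrow> s (s i) = i"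
    and c: "\<And>i. i < n \<Longrightarrow> c (s i) = cnj (c i)" "\<And>i. i < n \<Longrightarrow> cmod (c i) = 1"
    and x: "x \<in> carrier_vec n" "\<And>i. i < n \<Longrightarrow> c i * x $ s i + x $ i = 0"
  defines "g \<equiv> (monomial_mat n c s, x)"
  shows "g \<in> carrier (affine_unitary_group n)"
    "g \<otimes>\<^bsub>affine_unitary_group n\<^esub> g = \<one>\<^bsub>affine_unitary_group n\<^esub>"
proof -
  let ?M = "monomial_mat n c s"
  have cc: "c i * cnj (c i) = 1" if "i < n" for i
    using c(2)[OF that] by (metis complex_norm_square of_real_1 power_one)
  have adj: "mat_adjoint ?M = ?M"
  proof (rule eq_matI)
    fix i j assume "i < dim_row ?M" "j < dim_col ?M"
    then have ij: "i < n" "j < n" by (simp_all add: monomial_mat_def)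
    have "i = s j \<longleftrightarrow> j = s i" using s(2) ij by auto
    then show "mat_adjoint ?M $$ (i, j) = ?M $$ (i, j)"
      using ij c(1)[OF ij(1)] by (auto simp: monomial_mat_def)
  qed (simp_all add: monomial_mat_def)
  have sq: "?M * ?M = 1\<^sub>m n"
  proof -
    have "?M * ?M = mat_diag n (\<lambda>i. 1)"
      by (subst monomial_mat_mult[OF s(1)], assumption, rule monomial_mat_eq_diag)
         (simp_all add: s c(1) cc)
    then show ?thesis by simp
  qed
  have "?M *\<^sub>v x + x = 0\<^sub>v n"
    using x by (subst monomial_mat_mult_vec[OF x(1) s(1)]) (auto intro!: eq_vecI)
  then show "g \<in> carrier (affine_unitary_group n)"
    "g \<otimes>\<^bsub>affine_unitary_group n\<^esub> g = \<one>\<^bsub>affine_unitary_group n\<^esub>"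
    using x(1) by (simp_all add: g_def affine_unitary_group_def unitary_matI adj sq)
qed

section \<open>Factorization into two affine involutions\<close>

text \<open>The element is written as \<open>h\<close> times \<open>k\<close> with linear parts
  monomial along \<open>s\<close>. Given \<open>e\<close> and \<open>v\<close>, the product
  determines \<open>c\<close> and \<open>x\<close>; it remains to choose \<open>e\<close> and
  \<open>v\<close> so that both factors are involutions.\<close>

lemma diagonal_strongly_reversible:
  assumes d: "\<forall>i<n. cmod (d i) = 1"
    and card: "\<And>a. card {i \<in> {..<n}. d i = cnj a} = card {i \<in> {..<n}. d i = a}"
    and w: "w \<in> carrier_vec n"
  shows "strongly_reversible (affine_unitary_group n) (mat_diag n d, w)"
proof -
  interpret group "affine_unitary_group n" by (rule group_affine_unitary_group)
  obtain s where s: "\<And>i. i \<in> {..<n} \<Longrightarrow> s i \<in> {..<n}" "\<And>i. i \<in> {..<n} \<Longrightarrow> s (s i) = i"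
    "\<And>i. i \<in> {..<n} \<Longrightarrow> d (s i) = cnj (d i)" and s_real: "\<And>i. d i \<in> \<real> \<Longrightarrow> s i = i"
    by (rule conj_involution[OF finite_lessThan card]) blast
  have s_lt: "s i < n" and ss: "s (s i) = i" and ds: "d (s i) = cnj (d i)" if "i < n" for i
    using s that by auto
  have dd: "d i * cnj (d i) = 1" if "i < n" for i
    using d[rule_format, OF that] by (metis complex_norm_square of_real_1 power_one)
  have s1: "s i = i" if "d i = 1" for i using s_real that by simp
  have ds1: "d (s i) = 1 \<longleftrightarrow> d i = 1" if "i < n" for i
    using ds[OF that] by (metis complex_cnj_cnj complex_cnj_one)
  \<comment> \<open>At an index with \<open>d i = 1\<close>, which \<open>s\<close> fixes, the
    choice \<open>e i = 1\<close> would make both involution conditions force zero translation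
    entries and hence \<open>w $ i = 0\<close>.\<close>
  define e where "e i = (if d i = 1 then -1 else 1 :: complex)" for i
  \<comment> \<open>Where \<open>d i = 1\<close> the division by zero yields \<open>v i = 0\<close>, which is the value needed there.\<close>
  define v where "v i = - (cnj (d i) * w $ i + w $ s i) / (1 - cnj (d i))" for i
  \<comment> \<open>Chosen to give \<open>e i * c (s i) = d i\<close>.\<close>
  define c where "c i = e i * cnj (d i)" for i
  \<comment> \<open>This solves \<open>e i * x (s i) + v i = w $ i\<close>, given that
    \<open>e i * v (s i) = - v i\<close>.\<close>
  define x where "x i = e i * w $ s i + v i" for i
  have es: "e (s i) = e i" if "i < n" for i
    using ds1[OF that] by (simp add: e_def)
  have e2: "e i * e i = 1" "cnj (e i) = e i" "cmod (e i) = 1" for i by (simp_all add: e_def)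
  have v1: "v i = 0" if "d i = 1" for i using that by (simp add: v_def)
  have veq: "v i * (1 - cnj (d i)) = - (cnj (d i) * w $ i + w $ s i)" if "d i \<noteq> 1" for i
    using that by (simp add: v_def)
  \<comment> \<open>This yields the involution condition for \<open>h\<close>. Multiplying the
    equation \<open>veq\<close> for \<open>v i\<close> by \<open>d i\<close> turns its right side
    into that for \<open>v (s i)\<close> and the factor \<open>1 - cnj (d i)\<close> into
    \<open>- (1 - d i)\<close>.\<close>
  have vs: "v (s i) = - v i" if i: "i < n" for i
  proof (cases "d i = 1")
    case True
    then show ?thesis using ds1[OF i] by (simp add: v1)
  next
    case False
    have "v (s i) * (1 - d i) = - (d i * w $ s i + w $ i)"
      using veq[of "s i"] ds1[OF i] False by (simp add: ds[OF i] ss[OF i])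
    also have "\<dots> = - v i * (1 - d i)"
    proof -
      have "- (d i * w $ s i + w $ i)
          = d i * - (cnj (d i) * w $ i + w $ s i) + (d i * cnj (d i) - 1) * w $ i"
        by (simp add: algebra_simps)
      also have "\<dots> = d i * (v i * (1 - cnj (d i)))"
        using veq[OF False] dd[OF i] by simp
      also have "\<dots> = - v i * (1 - d i) - (d i * cnj (d i) - 1) * v i"
        by (simp add: algebra_simps)
      finally show ?thesis using dd[OF i] by simp
    qed
  finally show ?thesis using False mult_right_cancel[of "1 - d i" "v (s i)" "- v i"] by simp
  qed
  \<comment> \<open>The sign \<open>e i\<close> differs from 1 only where \<open>v i\<close>
    vanishes.\<close>
  have ev: "e i * v i = v i" for i by (cases "d i = 1") (simp_all add: v1 e_def)
  define h where "h = (monomial_mat n e s, vec n v)"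
  define k where "k = (monomial_mat n c s, vec n x)"
  have h: "h \<in> carrier (affine_unitary_group n)"
    "h \<otimes>\<^bsub>affine_unitary_group n\<^esub> h = \<one>\<^bsub>affine_unitary_group n\<^esub>"
    unfolding h_def
    by (rule affine_monomial_involution; simp add: s_lt ss es e2 vs ev)+
  \<comment> \<open>For \<open>d i \<noteq> 1\<close> this is the equation \<open>veq\<close> that
    defines \<open>v\<close>. For \<open>d i = 1\<close> both \<open>c i\<close> and
    \<open>e i\<close> are -1, and the two terms cancel.\<close>
  have cx: "c i * x (s i) + x i = 0" if i: "i < n" for i
  proof (cases "d i = 1")
    case True
    then show ?thesis by (simp add: c_def x_def s1 v1 e_def)
  next
    case False
    then show ?thesis
      using veq[OF False] False ds1[OF i]
      by (simp add: c_def x_def ss[OF i] vs[OF i] e_def algebra_simps)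
  qed
  have cs: "c (s i) = cnj (c i)" "cmod (c i) = 1" if "i < n" for i
    using that d by (simp_all add: c_def es e2 ds norm_mult)
  have k: "k \<in> carrier (affine_unitary_group n)"
    "k \<otimes>\<^bsub>affine_unitary_group n\<^esub> k = \<one>\<^bsub>affine_unitary_group n\<^esub>"
    unfolding k_def
    by (rule affine_monomial_involution; simp add: s_lt ss cx cs)+
  have "monomial_mat n e s * monomial_mat n c s = mat_diag n d"
    by (subst monomial_mat_mult[OF s_lt], assumption, rule monomial_mat_eq_diag)
       (simp_all add: ss c_def es ds e2 mult.assoc[symmetric])
  moreover have "monomial_mat n e s *\<^sub>v vec n x + vec n v = w"
  proof -
    have "e i * x (s i) + v i = w $ i" if "i < n" for i
      using that by (simp add: x_def right_diff_distrib mult.assoc[symmetric] es e2 ss vs ev)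
    then show ?thesis
      using w by (intro eq_vecI) (auto simp: monomial_mat_mult_vec s_lt)
  qed
  ultimately have "h \<otimes>\<^bsub>affine_unitary_group n\<^esub> k = (mat_diag n d, w)"
    by (simp add: h_def k_def affine_unitary_group_def)
  with strongly_reversible_mult_involutions[OF h(1) k(1) h(2) k(2)] show ?thesis by simp
qed

section \<open>Return to the original basis and the equivalence\<close>

text \<open>Conjugation by the linear map \<open>(U, 0\<^sub>v n)\<close> carries the diagonal case
  to \<open>(A, w)\<close> and preserves strong reversibility.\<close>

lemma self_dual_imp_strongly_reversible:
  assumes A: "unitary_mat n A" and w: "w \<in> carrier_vec n" and sd: "self_dual (char_poly A)"
  shows "strongly_reversible (affine_unitary_group n) (A, w)"
proof -
  interpret group "affine_unitary_group n" by (rule group_affine_unitary_group)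
  obtain U d where U: "unitary_mat n U" and AU: "A = U * mat_diag n d * mat_adjoint U"
    and D: "unitary_mat n (mat_diag n d)" and d: "\<forall>i<n. cmod (d i) = 1"
    using unitary_mat_spectral[OF A] by blast
  note Uc = unitary_mat_carrier[OF U] and Ua = unitary_mat_carrier[OF unitary_mat_adjoint[OF U]]
  have UU: "mat_adjoint U * U = 1\<^sub>m n" "U * mat_adjoint U = 1\<^sub>m n"
    using U by (auto simp: unitary_mat_def)
  define u where "u = (U, 0\<^sub>v n :: complex vec)"
  \<comment> \<open>The translation part is \<open>w\<close> in eigenbasis coordinates, so that
    \<open>U\<close> brings it back to \<open>w\<close>.\<close>
  define g where "g = (mat_diag n d, mat_adjoint U *\<^sub>v w)"
  have g: "g \<in> carrier (affine_unitary_group n)"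
    using D Ua w by (simp add: g_def affine_unitary_group_def)
  have u: "u \<in> carrier (affine_unitary_group n)"
    using U by (simp add: u_def affine_unitary_group_def)
  have "strongly_reversible (affine_unitary_group n) g"
    using diagonal_strongly_reversible[OF d] sd Ua w
    unfolding AU card_roots_conj_iff_self_dual[OF U d] g_def by simp
  then have "strongly_reversible (affine_unitary_group n)
      (u \<otimes>\<^bsub>affine_unitary_group n\<^esub> g \<otimes>\<^bsub>affine_unitary_group n\<^esub> inv\<^bsub>affine_unitary_group n\<^esub> u)"
    by (rule strongly_reversible_hom[OF is_group is_group conjugation_hom[OF u] g])
  moreover have zero: "C *\<^sub>v 0\<^sub>v n = 0\<^sub>v n" if "C \<in> carrier_mat n n" for C :: "complex mat"
    using that by (intro eq_vecI) auto
  then have "inv\<^bsub>affine_unitary_group n\<^esub> u = (mat_adjoint U, 0\<^sub>v n)"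
    using u U Ua unitary_mat_adjoint[OF U] zero
    by (intro inv_equality) (auto simp: u_def affine_unitary_group_def UU)
  moreover have "u \<otimes>\<^bsub>affine_unitary_group n\<^esub> g \<otimes>\<^bsub>affine_unitary_group n\<^esub> (mat_adjoint U, 0\<^sub>v n) = (A, w)"
    using Uc Ua w
    by (simp add: zero[of "U * mat_diag n d"] u_def g_def affine_unitary_group_def AU UU
        assoc_mult_mat_vec[of _ n n _ n, symmetric])
  ultimately show ?thesis by simp
qed

theorem theorem1p5:
  fixes n :: nat and A :: "complex mat" and w :: "complex vec"
  assumes "n \<ge> 1"
    and "(A, w) \<in> carrier (affine_unitary_group n)"
  shows "(reversible (affine_unitary_group n) (A, w)
            \<longleftrightarrow> strongly_reversible (affine_unitary_group n) (A, w))
       \<and> (strongly_reversible (affine_unitary_group n) (A, w)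
            \<longleftrightarrow> strongly_reversible (unitary_group n) A)
       \<and> (strongly_reversible (unitary_group n) A
            \<longleftrightarrow> self_dual (char_poly A))"
proof -
  have A: "unitary_mat n A" and w: "w \<in> carrier_vec n"
    using assms(2) by (auto simp: affine_unitary_group_def)
  \<comment> \<open>Either kind of reversibility of \<open>(A, w)\<close> descends to
    \<open>A\<close>; reversibility of \<open>A\<close> makes the polynomial self-dual, which in
    turn yields strong reversibility of \<open>(A, w)\<close> and closes the cycle.\<close>
  note proj = group_affine_unitary_group group_unitary_group fst_hom assms(2)
  show ?thesis
    using reversible_hom[OF proj] strongly_reversible_hom[OF proj]
      strongly_reversible_imp_reversible[of "affine_unitary_group n" "(A, w)"]
      strongly_reversible_imp_reversible[of "unitary_group n" A] reversible_imp_self_dual[OF A]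
      self_dual_imp_strongly_reversible[OF A w]
    by auto
qed

end
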